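(* Let $S$ be an intra-regular LA-semigroup with left identity and let $A$ be a nonempty subset of $S$. Then the following conditions are equivalent: (i) $A$ is a $(1,2)$-ideal of $S$; (ii) $(AS)A^{2}=A$ and $A^{2}=A$.
   Context: An LA-semigroup (left almost semigroup) is a nonempty set $S$ with a binary operation, written as juxtaposition, satisfying the left invertive law $(ab)c=(cb)a$ for all $a,b,c\in S$ (associativity and commutativity are not assumed). A left identity is an element $e\in S$ with $ea=a$ for all $a\in S$. For subsets $A,B\subseteq S$, $AB=\{ab: a\in A,\ b\in B\}$ and $A^2=AA$. A nonempty subset $A\subseteq S$ is an LA-subsemigroup if $A^2\subseteq A$; an LA-subsemigroup $A$ is a $(1,2)$-ideal if $(AS)A^{2}\subseteq A$. $S$ is intra-regular if for every $a\in S$ there exist $x,y\in S$ such that $a=(xa^{2})y$, where $a^2=aa$. *)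

theory Defs
  imports Main
begin

locale la_semigroup =
  fixes S :: "'a set" and mult :: "'a \<Rightarrow> 'a \<Rightarrow> 'a"  (infixl "\<cdot>" 70)
  assumes nonempty: "S \<noteq> {}"
    and closed: "\<lbrakk>a \<in> S; b \<in> S\<rbrakk> \<Longrightarrow> a \<cdot> b \<in> S"
    and left_invertive: "\<lbrakk>a \<in> S; b \<in> S; c \<in> S\<rbrakk> \<Longrightarrow> (a \<cdot> b) \<cdot> c = (c \<cdot> b) \<cdot> a"

definition left_identity :: "'a set \<Rightarrow> ('a \<Rightarrow> 'a \<Rightarrow> 'a) \<Rightarrow> 'a \<Rightarrow> bool" where
  "left_identity S mult e \<longleftrightarrow> e \<in> S \<and> (\<forall>a\<in>S. mult e a = a)"

definition intra_regular :: "'a set \<Rightarrow> ('a \<Rightarrow> 'a \<Rightarrow> 'a) \<Rightarrow> bool" where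
  "intra_regular S mult \<longleftrightarrow>
     (\<forall>a\<in>S. \<exists>x\<in>S. \<exists>y\<in>S. a = mult (mult x (mult a a)) y)"

definition set_prod :: "('a \<Rightarrow> 'a \<Rightarrow> 'a) \<Rightarrow> 'a set \<Rightarrow> 'a set \<Rightarrow> 'a set" where
  "set_prod mult A B = {mult a b | a b. a \<in> A \<and> b \<in> B}"

definition la_subsemigroup :: "'a set \<Rightarrow> ('a \<Rightarrow> 'a \<Rightarrow> 'a) \<Rightarrow> 'a set \<Rightarrow> bool" where
  "la_subsemigroup S mult A \<longleftrightarrow> A \<noteq> {} \<and> A \<subseteq> S \<and> set_prod mult A A \<subseteq> A"

definition one_two_ideal :: "'a set \<Rightarrow> ('a \<Rightarrow> 'a \<Rightarrow> 'a) \<Rightarrow> 'a set \<Rightarrow> bool" where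
  "one_two_ideal S mult A \<longleftrightarrow>
     la_subsemigroup S mult A \<and>
     set_prod mult (set_prod mult A S) (set_prod mult A A) \<subseteq> A"

end

theory Submission
  imports Defs
begin

text \<open>
  Only the inclusions of \<open>A\<close> in \<open>(AS)A\<^sup>2\<close> and in \<open>A\<^sup>2\<close> for a \<open>(1,2)\<close>-ideal \<open>A\<close> need an
  argument. Both follow from one fact about single elements, \<open>left_multiple_absorbed\<close>: in an
  intra-regular LA-semigroup with left identity, every left multiple \<open>sa\<close> of \<open>a\<close> lies in
  \<open>(aS)a\<^sup>2\<close>. Taking \<open>s\<close> to be the left identity gives \<open>a \<in> (aS)a\<^sup>2\<close>. Next, \<open>a = za\<^sup>2\<close> for some
  \<open>z\<close> (\<open>eq_mult_square\<close>), so \<open>a = z(aa) = a(za)\<close>; the factor \<open>za\<close> lies in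
  \<open>(aS)a\<^sup>2\<close>, hence in \<open>A\<close>, and \<open>a\<close> is a product of two elements of \<open>A\<close>.

  To see the fact, put \<open>a = za\<^sup>2\<close> into \<open>sa\<close>, and then \<open>a\<^sup>2 = (za\<^sup>2)(za\<^sup>2) = z\<^sup>2(a\<^sup>2a\<^sup>2)\<close> into the
  result. Successive left factors can be merged (\<open>left_factors_merge\<close>), which gives
  \<open>sa = v(a\<^sup>2a\<^sup>2)\<close> for some \<open>v\<close>. Enough copies of \<open>a\<close> are now present to bring one of
  them to the front by the medial and paramedial laws.
\<close>

locale la_semigroup_left_identity = la_semigroup +
  fixes e
  assumes left_identity: "left_identity S mult e"
begin

lemma left_identity_closed: "e \<in> S"
  and left_identity_mult: "a \<in> S \<Longrightarrow> e \<cdot> a = a"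
  using left_identity by (auto simp: left_identity_def)

lemma medial:
  assumes "a \<in> S" "b \<in> S" "c \<in> S" "d \<in> S"
  shows "(a \<cdot> b) \<cdot> (c \<cdot> d) = (a \<cdot> c) \<cdot> (b \<cdot> d)"
proof -
  have "(a \<cdot> b) \<cdot> (c \<cdot> d) = ((c \<cdot> d) \<cdot> b) \<cdot> a"
    using assms by (intro left_invertive closed)
  also have "(c \<cdot> d) \<cdot> b = (b \<cdot> d) \<cdot> c"
    using assms by (intro left_invertive)
  also have "((b \<cdot> d) \<cdot> c) \<cdot> a = (a \<cdot> c) \<cdot> (b \<cdot> d)"
    using assms by (intro left_invertive closed)
  finally show ?thesis .
qed

lemma left_commute:
  assumes "a \<in> S" "b \<in> S" "c \<in> S"
  shows "a \<cdot> (b \<cdot> c) = b \<cdot> (a \<cdot> c)"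
  using medial[OF left_identity_closed assms] assms by (simp add: left_identity_mult)

lemma paramedial:
  assumes "a \<in> S" "b \<in> S" "c \<in> S" "d \<in> S"
  shows "(a \<cdot> b) \<cdot> (c \<cdot> d) = (d \<cdot> b) \<cdot> (c \<cdot> a)"
proof -
  have "(a \<cdot> b) \<cdot> (c \<cdot> d) = c \<cdot> ((a \<cdot> b) \<cdot> d)"
    using assms by (intro left_commute closed)
  also have "(a \<cdot> b) \<cdot> d = (d \<cdot> b) \<cdot> a"
    using assms by (intro left_invertive)
  also have "c \<cdot> ((d \<cdot> b) \<cdot> a) = (d \<cdot> b) \<cdot> (c \<cdot> a)"
    using assms by (intro left_commute closed)
  finally show ?thesis .
qed

text \<open>A substitute for associativity: \<open>s(tc)\<close> is again a left multiple of \<open>c\<close>.\<close>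

lemma left_factors_merge:
  assumes "s \<in> S" "t \<in> S" "c \<in> S"
  shows "s \<cdot> (t \<cdot> c) = ((t \<cdot> e) \<cdot> s) \<cdot> c"
proof -
  have "s \<cdot> (t \<cdot> c) = (e \<cdot> s) \<cdot> (t \<cdot> c)"
    using assms by (simp add: left_identity_mult)
  also have "\<dots> = (c \<cdot> s) \<cdot> (t \<cdot> e)"
    using assms left_identity_closed by (intro paramedial)
  also have "\<dots> = ((t \<cdot> e) \<cdot> s) \<cdot> c"
    using assms left_identity_closed by (intro left_invertive closed)
  finally show ?thesis .
qed

text \<open>
  Squares can be moved to the left of any factor, \<open>xa\<^sup>2 = a\<^sup>2(xe)\<close>; the left
  invertive law then collects both multipliers of \<open>(xa\<^sup>2)y\<close> on the left.
\<close>

lemma eq_mult_square: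
  assumes "intra_regular S mult" and a: "a \<in> S"
  obtains z where "z \<in> S" "a = z \<cdot> (a \<cdot> a)"
proof -
  obtain x y where x: "x \<in> S" and y: "y \<in> S" and eq: "a = (x \<cdot> (a \<cdot> a)) \<cdot> y"
    using assms unfolding intra_regular_def by blast
  note [simp] = closed left_identity_closed left_identity_mult a x y
  have "x \<cdot> (a \<cdot> a) = (a \<cdot> x) \<cdot> (a \<cdot> e)"
    using paramedial[of e x a a] by simp
  also have "\<dots> = (a \<cdot> a) \<cdot> (x \<cdot> e)"
    by (intro medial) simp_all
  finally have "a = ((a \<cdot> a) \<cdot> (x \<cdot> e)) \<cdot> y"
    using eq by simp
  also have "\<dots> = (y \<cdot> (x \<cdot> e)) \<cdot> (a \<cdot> a)"
    by (intro left_invertive) simp_all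
  finally show thesis
    by (intro that[of "y \<cdot> (x \<cdot> e)"]) simp_all
qed

lemma left_multiple_absorbed:
  assumes "intra_regular S mult" and a: "a \<in> S" and s: "s \<in> S"
  obtains t where "t \<in> S" "s \<cdot> a = (a \<cdot> t) \<cdot> (a \<cdot> a)"
proof -
  obtain z where z: "z \<in> S" and az: "a = z \<cdot> (a \<cdot> a)"
    using eq_mult_square assms(1) a by blast
  note [simp] = closed left_identity_closed left_identity_mult a s z
  define u where "u = (z \<cdot> e) \<cdot> s"
  define v where "v = ((z \<cdot> z) \<cdot> e) \<cdot> u"
  have [simp]: "u \<in> S" "v \<in> S"
    by (simp_all add: u_def v_def)
  have "s \<cdot> a = s \<cdot> (z \<cdot> (a \<cdot> a))"
    using az by simp
  also have "\<dots> = u \<cdot> (a \<cdot> a)"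
    unfolding u_def by (intro left_factors_merge) simp_all
  also have "a \<cdot> a = (z \<cdot> (a \<cdot> a)) \<cdot> (z \<cdot> (a \<cdot> a))"
    using az by simp
  also have "\<dots> = (z \<cdot> z) \<cdot> ((a \<cdot> a) \<cdot> (a \<cdot> a))"
    by (intro medial) simp_all
  also have "u \<cdot> \<dots> = v \<cdot> ((a \<cdot> a) \<cdot> (a \<cdot> a))"
    unfolding v_def by (intro left_factors_merge) simp_all
  also have "\<dots> = (a \<cdot> a) \<cdot> (v \<cdot> (a \<cdot> a))"
    by (intro left_commute) simp_all
  also have "v \<cdot> (a \<cdot> a) = a \<cdot> (v \<cdot> a)"
    by (intro left_commute) simp_all
  also have "(a \<cdot> a) \<cdot> (a \<cdot> (v \<cdot> a)) = ((v \<cdot> a) \<cdot> a) \<cdot> (a \<cdot> a)"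
    by (intro paramedial) simp_all
  also have "(v \<cdot> a) \<cdot> a = (a \<cdot> a) \<cdot> v"
    by (intro left_invertive) simp_all
  \<comment> \<open>Splitting \<open>v\<close> as \<open>ev\<close> lets the medial law separate the two copies of \<open>a\<close>.\<close>
  also have "\<dots> = (a \<cdot> e) \<cdot> (a \<cdot> v)"
    using medial[of a a e v] by simp
  also have "\<dots> = a \<cdot> ((a \<cdot> e) \<cdot> v)"
    by (intro left_commute) simp_all
  finally show thesis
    by (intro that[of "(a \<cdot> e) \<cdot> v"]) simp_all
qed

lemma left_multiple_in_one_two_product:
  assumes "intra_regular S mult" and "A \<subseteq> S" and "a \<in> A" and "s \<in> S"
  shows "s \<cdot> a \<in> set_prod mult (set_prod mult A S) (set_prod mult A A)"
proof -
  obtain t where "t \<in> S" "s \<cdot> a = (a \<cdot> t) \<cdot> (a \<cdot> a)"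
    using left_multiple_absorbed assms by blast
  then show ?thesis
    using \<open>a \<in> A\<close> unfolding set_prod_def by blast
qed

end

theorem theorem11:
  fixes S A :: "'a set" and mult :: "'a \<Rightarrow> 'a \<Rightarrow> 'a"
  assumes "la_semigroup S mult"
    and "\<exists>e. left_identity S mult e"
    and "intra_regular S mult"
    and "A \<subseteq> S" and "A \<noteq> {}"
  shows "one_two_ideal S mult A \<longleftrightarrow>
    set_prod mult (set_prod mult A S) (set_prod mult A A) = A \<and> set_prod mult A A = A"
proof
  let ?P = "set_prod mult (set_prod mult A S) (set_prod mult A A)"
  obtain e where "left_identity S mult e"
    using assms(2) by blast
  then interpret la_semigroup_left_identity S mult e
    using assms(1)
    by (simp add: la_semigroup_left_identity_def la_semigroup_left_identity_axioms_def)
  assume "one_two_ideal S mult A"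
  then have P: "?P \<subseteq> A" and A2: "set_prod mult A A \<subseteq> A"
    by (auto simp: one_two_ideal_def la_subsemigroup_def)
  have absorbed: "mult s a \<in> ?P" if "a \<in> A" "s \<in> S" for a s
    using left_multiple_in_one_two_product assms(3,4) that by blast
  have "a \<in> ?P" if "a \<in> A" for a
    using absorbed[OF that left_identity_closed] left_identity_mult that assms(4) by auto
  moreover have "a \<in> set_prod mult A A" if "a \<in> A" for a
  proof -
    have a: "a \<in> S"
      using that assms(4) by blast
    obtain z where z: "z \<in> S" and "a = mult z (mult a a)"
      using eq_mult_square assms(3) a by blast
    then have "a = mult a (mult z a)"
      using left_commute[OF z a a] by simp
    moreover have "mult z a \<in> A"
      using absorbed[OF that z] P by blast
    ultimately show ?thesis
      using that unfolding set_prod_def by blast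
  qed
  ultimately show "?P = A \<and> set_prod mult A A = A"
    using P A2 by blast
next
  assume "set_prod mult (set_prod mult A S) (set_prod mult A A) = A \<and> set_prod mult A A = A"
  then show "one_two_ideal S mult A"
    using assms(4,5) unfolding one_two_ideal_def la_subsemigroup_def by blast
qed

end
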